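(* Suppose there exist an infinite set $\Omega$ and a binary relation $\mathcal{R} \subset \Omega \times \Omega$ such that (1) $|\mathcal{R}| < |\operatorname{Sym}(\Omega)|$ and $|\mathcal{R}^c| < |\operatorname{Sym}(\Omega)|$, and (2) $\operatorname{Aut}(\Omega, \mathcal{R}) = \{\mathrm{id}\}$. Then there exist an infinite group $G$ and disjoint subsets $A, B \subset G$ with $|A| < |G|$ and $|B| < |G|$ such that $A$ and $B$ are not separable in $G$.
   Context: All arguments are in ZFC. $\operatorname{Sym}(\Omega)$ is the group of all permutations of $\Omega$, $\mathcal{R}^c = (\Omega \times \Omega) \setminus \mathcal{R}$, and $\operatorname{Aut}(\Omega, \mathcal{R}) := \{\sigma \in \operatorname{Sym}(\Omega) : u\mathcal{R}v \iff \sigma(u)\mathcal{R}\sigma(v) \text{ for all } u, v \in \Omega\}$. For an infinite group $G$ with identity $e$ and disjoint subsets $A, B \subset G$, we say $A$ and $B$ are separable in $G$ if there exists a subset $X \subset G$ such that (1) $X$ is infinite; (2) $e \in X$; (3) $X = X^{-1}$, i.e. $x \in X \Rightarrow x^{-1} \in X$; (4) $XAX \cap B = \varnothing$, where $XAX = \{x a x' : x, x' \in X,\ a \in A\}$. *)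

theory Defs
  imports "HOL-Algebra.Coset" "HOL-Algebra.Bij" "HOL-Library.Equipollence"
begin

text \<open>
  \<open>Sym(\<Omega>)\<close> is \<^term>\<open>Bij \<Omega>\<close>, the carrier of \<^term>\<open>BijGroup \<Omega>\<close>: a permutation of
  \<open>\<Omega>\<close> is represented by a function that is \<open>undefined\<close> outside \<open>\<Omega>\<close>, so that distinct
  elements of \<^term>\<open>Bij \<Omega>\<close> are distinct permutations and the identity is
  \<^term>\<open>\<lambda>x\<in>\<Omega>. x\<close>.
\<close>

definition relation_aut :: "'a set \<Rightarrow> ('a \<times> 'a) set \<Rightarrow> ('a \<Rightarrow> 'a) set" where
  "relation_aut \<Omega> R = {\<sigma> \<in> Bij \<Omega>. \<forall>u\<in>\<Omega>. \<forall>v\<in>\<Omega>. (u, v) \<in> R \<longleftrightarrow> (\<sigma> u, \<sigma> v) \<in> R}"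

text \<open>Meant for an infinite group \<open>G\<close> and disjoint subsets \<open>A\<close>, \<open>B\<close> of its carrier.\<close>

definition separable_in :: "('g, 'm) monoid_scheme \<Rightarrow> 'g set \<Rightarrow> 'g set \<Rightarrow> bool" where
  "separable_in G A B \<longleftrightarrow>
     (\<exists>X \<subseteq> carrier G.
        infinite X \<and> \<one>\<^bsub>G\<^esub> \<in> X \<and> X = set_inv\<^bsub>G\<^esub> X \<and>
        ((X <#>\<^bsub>G\<^esub> A) <#>\<^bsub>G\<^esub> X) \<inter> B = {})"

end

theory Submission
  imports Defs "HOL-Combinatorics.Transposition"
begin

text \<open>
  The group is \<open>G = Sym(\<Omega>)\<close>. If \<open>x\<close> lies in a set \<open>X\<close> witnessing separability, then so does
  \<open>x\<inverse>\<close>, and \<open>X A X\<close> contains \<open>x A x\<inverse>\<close>. So let \<open>C\<close> be a conjugation-invariant set, \<open>A \<subseteq> C\<close>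
  and \<open>B = C - A\<close>: a separating \<open>X\<close> consists of elements that normalize \<open>A\<close>. If only the
  identity normalizes \<open>A\<close>, there is no infinite \<open>X\<close> (\<open>not_separable_if_rigid\<close>).

  It remains to find a set of permutations that is rigid under conjugation and small; this
  is where the rigid relation \<open>R\<close> enters. For \<open>C\<close> take the transpositions, the 3-cycles and
  the identity, which form an image of \<open>\<Omega> \<times> \<Omega> \<times> \<Omega>\<close> and hence have at most \<open>|\<Omega>|\<close> elements.
  As \<open>\<Omega>\<close> is infinite, it can be split into a point \<open>p\<close> and two copies \<open>l(\<Omega>)\<close> and \<open>r(\<Omega>)\<close> of
  itself. The 3-cycles \<open>(p, l u, r u)\<close>, for \<open>u \<in> \<Omega>\<close>, record this splitting: \<open>p\<close> is the only
  point moved by all of them, and their orientation tells \<open>l u\<close> from \<open>r u\<close>. The transpositions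
  \<open>(l u, r v)\<close>, for \<open>(u, v) \<in> R\<close>, record the relation; a pair and its reverse, and also loops,
  get distinct transpositions because the two copies are disjoint. For the set \<open>A\<close> of all
  these permutations, a permutation that normalizes \<open>A\<close> fixes \<open>p\<close> and acts on both copies by
  one and the same automorphism of \<open>R\<close>, so it is the identity (\<open>rel_code_rigid\<close>).

  Finally \<open>|\<Omega>| = |\<Omega> \<times> \<Omega>| < |Sym(\<Omega>)|\<close>, because \<open>\<Omega> \<times> \<Omega>\<close> is the union of \<open>R\<close> and its
  complement, which are both smaller than the infinite set \<open>Sym(\<Omega>)\<close>.
\<close>

section \<open>Rigid sets are not separable from their complement in an invariant set\<close>

lemma (in group) not_separable_if_rigid:
  assumes A: "A \<subseteq> C" and C: "C \<subseteq> carrier G"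
    and invariant: "\<And>x a. x \<in> carrier G \<Longrightarrow> a \<in> C \<Longrightarrow> x \<otimes> a \<otimes> inv x \<in> C"
    and rigid: "\<And>x. x \<in> carrier G \<Longrightarrow> \<forall>a\<in>A. x \<otimes> a \<otimes> inv x \<in> A
                   \<Longrightarrow> \<forall>a\<in>A. inv x \<otimes> a \<otimes> x \<in> A \<Longrightarrow> x = \<one>"
  shows "\<not> separable_in G A (C - A)"
proof
  assume "separable_in G A (C - A)"
  then obtain X where X: "X \<subseteq> carrier G" "infinite X" and sym: "X = set_inv X"
    and disj: "((X <#> A) <#> X) \<inter> (C - A) = {}"
    unfolding separable_in_def by blast
  have inv_X: "inv x \<in> X" if "x \<in> X" for x
    using that by (subst sym) (auto simp: SET_INV_def)
  have normalizes: "x \<otimes> a \<otimes> inv x \<in> A" if "x \<in> X" "a \<in> A" for x a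
  proof -
    have "x \<otimes> a \<otimes> inv x \<in> (X <#> A) <#> X"
      using that inv_X[of x] by (auto simp: set_mult_def)
    moreover have "x \<otimes> a \<otimes> inv x \<in> C"
      using that X(1) A by (intro invariant) auto
    ultimately show ?thesis using disj by blast
  qed
  have "x = \<one>" if x: "x \<in> X" for x
  proof (rule rigid)
    show "x \<in> carrier G" using x X(1) by blast
    then show "\<forall>a\<in>A. inv x \<otimes> a \<otimes> x \<in> A"
      using normalizes[OF inv_X[OF x]] by simp
  qed (use normalizes x in blast)
  then have "X \<subseteq> {\<one>}" by blast
  with X(2) show False using finite_subset by blast
qed

section \<open>Short cycles in the symmetric group\<close>

text \<open>
  For distinct points this is the 3-cycle \<open>a \<mapsto> b \<mapsto> c \<mapsto> a\<close>. Points may coincide, so that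
  transpositions have this form as well, as \<open>cycle3 \<Omega> a b b\<close>.
\<close>

definition cycle3 :: "'a set \<Rightarrow> 'a \<Rightarrow> 'a \<Rightarrow> 'a \<Rightarrow> 'a \<Rightarrow> 'a" where
  "cycle3 \<Omega> a b c = (\<lambda>z\<in>\<Omega>. transpose a b (transpose b c z))"

lemma transpose_Bij: "a \<in> \<Omega> \<Longrightarrow> b \<in> \<Omega> \<Longrightarrow> bij_betw (transpose a b) \<Omega> \<Omega>"
  by (simp add: bij_betw_transpose_iff)

lemma cycle3_Bij:
  assumes "a \<in> \<Omega>" "b \<in> \<Omega>" "c \<in> \<Omega>"
  shows "cycle3 \<Omega> a b c \<in> Bij \<Omega>"
proof -
  have "bij_betw (transpose a b \<circ> transpose b c) \<Omega> \<Omega>"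
    using assms by (blast intro: bij_betw_trans transpose_Bij)
  then show ?thesis by (simp add: cycle3_def Bij_def comp_def)
qed

lemma cycle3_apply:
  assumes "z \<in> \<Omega>" and "a \<noteq> b" "a \<noteq> c"
  shows "cycle3 \<Omega> a b c z = (if z = a then b else if z = c then a else if z = b then c else z)"
  using assms by (auto simp: cycle3_def transpose_def)

lemma Bij_apply_eq_iff:
  "x \<in> Bij \<Omega> \<Longrightarrow> y \<in> \<Omega> \<Longrightarrow> z \<in> \<Omega> \<Longrightarrow> x y = x z \<longleftrightarrow> y = z"
  by (auto simp: Bij_def bij_betw_def inj_on_eq_iff)

lemma Bij_apply_mem: "x \<in> Bij \<Omega> \<Longrightarrow> y \<in> \<Omega> \<Longrightarrow> x y \<in> \<Omega>"
  by (auto simp: Bij_def bij_betw_def)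

lemma carrier_BijGroup: "carrier (BijGroup \<Omega>) = Bij \<Omega>"
  by (simp add: BijGroup_def)

lemma one_BijGroup: "\<one>\<^bsub>BijGroup \<Omega>\<^esub> = (\<lambda>z\<in>\<Omega>. z)"
  by (simp add: BijGroup_def)

lemma mult_BijGroup: "x \<in> Bij \<Omega> \<Longrightarrow> y \<in> Bij \<Omega> \<Longrightarrow> x \<otimes>\<^bsub>BijGroup \<Omega>\<^esub> y = compose \<Omega> x y"
  by (simp add: BijGroup_def)

lemma inv_BijGroup:
  assumes x: "x \<in> Bij \<Omega>"
  shows "inv\<^bsub>BijGroup \<Omega>\<^esub> x \<in> Bij \<Omega>"
    and "\<And>z. z \<in> \<Omega> \<Longrightarrow> x ((inv\<^bsub>BijGroup \<Omega>\<^esub> x) z) = z"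
    and "\<And>z. z \<in> \<Omega> \<Longrightarrow> (inv\<^bsub>BijGroup \<Omega>\<^esub> x) (x z) = z"
proof -
  define y where "y = inv\<^bsub>BijGroup \<Omega>\<^esub> x"
  have y: "y \<in> Bij \<Omega>"
    using group.inv_closed[OF group_BijGroup, of x \<Omega>] x by (simp only: y_def carrier_BijGroup)
  have "x \<otimes>\<^bsub>BijGroup \<Omega>\<^esub> y = \<one>\<^bsub>BijGroup \<Omega>\<^esub>"
    unfolding y_def by (rule group.r_inv[OF group_BijGroup]) (simp add: carrier_BijGroup x)
  moreover have "y \<otimes>\<^bsub>BijGroup \<Omega>\<^esub> x = \<one>\<^bsub>BijGroup \<Omega>\<^esub>"
    unfolding y_def by (rule group.l_inv[OF group_BijGroup]) (simp add: carrier_BijGroup x)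
  ultimately have inverse: "compose \<Omega> x y = (\<lambda>z\<in>\<Omega>. z)" "compose \<Omega> y x = (\<lambda>z\<in>\<Omega>. z)"
    using x y by (simp_all only: mult_BijGroup one_BijGroup)
  show "inv\<^bsub>BijGroup \<Omega>\<^esub> x \<in> Bij \<Omega>" using y by (simp only: y_def)
  fix z assume z: "z \<in> \<Omega>"
  show "x ((inv\<^bsub>BijGroup \<Omega>\<^esub> x) z) = z"
    using fun_cong[OF inverse(1), of z] z unfolding y_def[symmetric] by (simp add: compose_def)
  show "(inv\<^bsub>BijGroup \<Omega>\<^esub> x) (x z) = z"
    using fun_cong[OF inverse(2), of z] z unfolding y_def[symmetric] by (simp add: compose_def)
qed

lemma Bij_apply_transpose:
  assumes "x \<in> Bij \<Omega>" "a \<in> \<Omega>" "b \<in> \<Omega>" "z \<in> \<Omega>"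
  shows "x (transpose a b z) = transpose (x a) (x b) (x z)"
  using assms by (simp add: transpose_def Bij_apply_eq_iff)

lemma conjugate_cycle3:
  assumes x: "x \<in> Bij \<Omega>" and abc: "a \<in> \<Omega>" "b \<in> \<Omega>" "c \<in> \<Omega>"
  shows "x \<otimes>\<^bsub>BijGroup \<Omega>\<^esub> cycle3 \<Omega> a b c \<otimes>\<^bsub>BijGroup \<Omega>\<^esub> inv\<^bsub>BijGroup \<Omega>\<^esub> x
           = cycle3 \<Omega> (x a) (x b) (x c)"
proof -
  have cycles: "cycle3 \<Omega> a b c \<in> Bij \<Omega>" "cycle3 \<Omega> (x a) (x b) (x c) \<in> Bij \<Omega>"
    using x abc by (simp_all add: cycle3_Bij Bij_apply_mem)
  have "transpose b c z \<in> \<Omega>" if "z \<in> \<Omega>" for z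
    using that abc by (simp add: transpose_def)
  then have "compose \<Omega> x (cycle3 \<Omega> a b c) = compose \<Omega> (cycle3 \<Omega> (x a) (x b) (x c)) x"
    using x abc by (simp add: fun_eq_iff compose_def cycle3_def Bij_apply_transpose Bij_apply_mem)
  then have "x \<otimes>\<^bsub>BijGroup \<Omega>\<^esub> cycle3 \<Omega> a b c = cycle3 \<Omega> (x a) (x b) (x c) \<otimes>\<^bsub>BijGroup \<Omega>\<^esub> x"
    using x cycles by (simp only: mult_BijGroup)
  then show ?thesis
    using x cycles group.inv_solve_right'[OF group_BijGroup] group.inv_closed[OF group_BijGroup]
    by (metis carrier_BijGroup group.is_monoid group_BijGroup monoid.m_closed)
qed

section \<open>Coding a relation by a set of permutations\<close>

locale doubling =
  fixes \<Omega> :: "'a set" and p :: 'a and l r :: "'a \<Rightarrow> 'a"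
  assumes split: "\<Omega> = insert p (l ` \<Omega> \<union> r ` \<Omega>)"
    and p_fresh: "p \<notin> l ` \<Omega>" "p \<notin> r ` \<Omega>"
    and disjoint: "l ` \<Omega> \<inter> r ` \<Omega> = {}"
    and inj: "inj_on l \<Omega>" "inj_on r \<Omega>"
begin

definition rel_code :: "('a \<times> 'a) set \<Rightarrow> ('a \<Rightarrow> 'a) set" where
  "rel_code R = {cycle3 \<Omega> p (l u) (r u) |u. u \<in> \<Omega>} \<union> {cycle3 \<Omega> (l u) (r v) (r v) |u v. (u, v) \<in> R}"

lemma p_mem: "p \<in> \<Omega>"
  using split by blast

lemma copies_mem: "u \<in> \<Omega> \<Longrightarrow> l u \<in> \<Omega>" "u \<in> \<Omega> \<Longrightarrow> r u \<in> \<Omega>"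
  using split by blast+

lemma distinct:
  assumes "u \<in> \<Omega>" "v \<in> \<Omega>"
  shows "l u \<noteq> p" "r u \<noteq> p" "p \<noteq> l u" "p \<noteq> r u" "l u \<noteq> r v" "r v \<noteq> l u"
    "l u = l v \<longleftrightarrow> u = v" "r u = r v \<longleftrightarrow> u = v"
  using assms p_fresh disjoint inj by (auto dest: inj_onD)

text \<open>The transpositions in the code are involutions and 3-cycles are not, so conjugation cannot mix
  the two kinds.\<close>

lemma proper_cycle_in_code:
  assumes code: "cycle3 \<Omega> a b c \<in> rel_code R" and R: "R \<subseteq> \<Omega> \<times> \<Omega>"
    and abc: "a \<in> \<Omega>" "b \<in> \<Omega>" "c \<in> \<Omega>" "a \<noteq> b" "a \<noteq> c" "b \<noteq> c"
  obtains u where "u \<in> \<Omega>" "cycle3 \<Omega> a b c = cycle3 \<Omega> p (l u) (r u)"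
proof -
  have "cycle3 \<Omega> a b c \<noteq> cycle3 \<Omega> (l u) (r v) (r v)" if "(u, v) \<in> R" for u v
  proof
    assume eq: "cycle3 \<Omega> a b c = cycle3 \<Omega> (l u) (r v) (r v)"
    have uv: "u \<in> \<Omega>" "v \<in> \<Omega>" using that R by auto
    let ?t = "cycle3 \<Omega> (l u) (r v) (r v)"
    have "?t (?t a) = a"
      using uv abc(1) by (simp add: cycle3_apply distinct copies_mem)
    moreover have "cycle3 \<Omega> a b c (cycle3 \<Omega> a b c a) = c"
      using abc by (simp add: cycle3_apply)
    ultimately show False using eq abc by simp
  qed
  then show thesis using code that by (auto simp: rel_code_def)
qed

lemma transposition_in_code:
  assumes code: "cycle3 \<Omega> (l u) (r v) (r v) \<in> rel_code R" and R: "R \<subseteq> \<Omega> \<times> \<Omega>"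
    and uv: "u \<in> \<Omega>" "v \<in> \<Omega>"
  shows "(u, v) \<in> R"
proof -
  let ?t = "cycle3 \<Omega> (l u) (r v) (r v)"
  have t: "?t (l u) = r v" "?t p = p"
    using uv by (simp_all add: cycle3_apply distinct copies_mem p_mem)
  have "?t \<noteq> cycle3 \<Omega> p (l w) (r w)" if "w \<in> \<Omega>" for w
  proof
    assume "?t = cycle3 \<Omega> p (l w) (r w)"
    moreover have "cycle3 \<Omega> p (l w) (r w) p = l w"
      using that by (simp add: cycle3_apply distinct copies_mem p_mem)
    ultimately show False using t(2) distinct[OF that that] by simp
  qed
  then obtain u' v' where R': "(u', v') \<in> R" and eq: "?t = cycle3 \<Omega> (l u') (r v') (r v')"
    using code by (auto simp: rel_code_def)
  have uv': "u' \<in> \<Omega>" "v' \<in> \<Omega>" using R R' by auto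
  have "cycle3 \<Omega> (l u') (r v') (r v') (l u) = (if u = u' then r v' else l u)"
    using uv uv' by (simp add: cycle3_apply distinct copies_mem)
  then have "u = u' \<and> v = v'"
    using t(1) eq uv uv' by (auto simp: distinct split: if_splits)
  then show ?thesis using R' by simp
qed

text \<open>
  The point \<open>p\<close> is recovered from the code as the common point of two of its 3-cycles; once
  it is known to be fixed, the orientation of the 3-cycles keeps the two copies apart.
\<close>

lemma code_preserving_acts_on_copies:
  assumes x: "x \<in> Bij \<Omega>" and R: "R \<subseteq> \<Omega> \<times> \<Omega>" and inf: "infinite \<Omega>"
    and pres: "\<forall>a\<in>rel_code R. x \<otimes>\<^bsub>BijGroup \<Omega>\<^esub> a \<otimes>\<^bsub>BijGroup \<Omega>\<^esub> inv\<^bsub>BijGroup \<Omega>\<^esub> x \<in> rel_code R"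
  shows "x p = p" and "\<And>u. u \<in> \<Omega> \<Longrightarrow> \<exists>u'\<in>\<Omega>. x (l u) = l u' \<and> x (r u) = r u'"
proof -
  note x_eq = Bij_apply_eq_iff[OF x]
  have image: "\<exists>u'\<in>\<Omega>. cycle3 \<Omega> (x p) (x (l u)) (x (r u)) = cycle3 \<Omega> p (l u') (r u')"
    if u: "u \<in> \<Omega>" for u
  proof -
    have "cycle3 \<Omega> p (l u) (r u) \<in> rel_code R" using u by (auto simp: rel_code_def)
    then have "cycle3 \<Omega> (x p) (x (l u)) (x (r u)) \<in> rel_code R"
      using pres x u by (metis conjugate_cycle3 p_mem copies_mem)
    then show ?thesis
      using R u by (elim proper_cycle_in_code)
        (auto simp: Bij_apply_mem[OF x] x_eq copies_mem p_mem distinct)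
  qed
  show xp: "x p = p"
  proof (rule ccontr)
    assume ne: "x p \<noteq> p"
    \<comment> \<open>If \<open>x p\<close> were different from \<open>p\<close>, it would determine the 3-cycle of the code that
      moves it, and hence also the point to which this 3-cycle takes \<open>x p\<close>.\<close>
    have cycle_unique: "w = w'"
      if "w \<in> \<Omega>" "w' \<in> \<Omega>" "cycle3 \<Omega> p (l w) (r w) (x p) \<noteq> x p"
        "cycle3 \<Omega> p (l w') (r w') (x p) \<noteq> x p" for w w'
      using that ne by (auto simp: cycle3_apply Bij_apply_mem[OF x] p_mem distinct split: if_splits)
    obtain u v where uv: "u \<in> \<Omega>" "v \<in> \<Omega>" "u \<noteq> v"
      using p_mem copies_mem(1) distinct(1) by metis
    obtain u' where u': "u' \<in> \<Omega>"
      "cycle3 \<Omega> (x p) (x (l u)) (x (r u)) = cycle3 \<Omega> p (l u') (r u')" using image uv(1) by blast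
    obtain v' where v': "v' \<in> \<Omega>"
      "cycle3 \<Omega> (x p) (x (l v)) (x (r v)) = cycle3 \<Omega> p (l v') (r v')" using image uv(2) by blast
    have at_xp: "cycle3 \<Omega> (x p) (x (l w)) (x (r w)) (x p) = x (l w)" "x (l w) \<noteq> x p"
      if "w \<in> \<Omega>" for w
      using that by (simp_all add: cycle3_apply Bij_apply_mem[OF x] x_eq copies_mem p_mem distinct)
    have "u' = v'"
      by (rule cycle_unique[OF u'(1) v'(1)]; fold u'(2) v'(2)) (use at_xp uv in simp_all)
    then have "x (l u) = x (l v)" using u'(2) v'(2) at_xp uv by metis
    then show False using uv by (simp add: x_eq copies_mem distinct)
  qed
  fix u assume u: "u \<in> \<Omega>"
  then obtain u' where u': "u' \<in> \<Omega>"
    and eq: "cycle3 \<Omega> p (x (l u)) (x (r u)) = cycle3 \<Omega> p (l u') (r u')"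
    using image xp by auto
  let ?c = "cycle3 \<Omega> p (x (l u)) (x (r u))"
  have ne: "x (l u) \<noteq> p" "x (r u) \<noteq> p" "x (l u) \<noteq> x (r u)"
    using u x_eq[OF _ p_mem] by (auto simp: xp x_eq copies_mem distinct)
  have "?c p = x (l u)" "?c (?c p) = x (r u)"
    using ne u by (simp_all add: cycle3_apply Bij_apply_mem[OF x] copies_mem p_mem)
  moreover have "?c p = l u'" "?c (?c p) = r u'"
    unfolding eq using u' by (simp_all add: cycle3_apply copies_mem p_mem distinct)
  ultimately show "\<exists>u'\<in>\<Omega>. x (l u) = l u' \<and> x (r u) = r u'" using u' by metis
qed

lemma code_preserving_preserves_rel:
  assumes x: "x \<in> Bij \<Omega>" and R: "R \<subseteq> \<Omega> \<times> \<Omega>"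
    and pres: "\<forall>a\<in>rel_code R. x \<otimes>\<^bsub>BijGroup \<Omega>\<^esub> a \<otimes>\<^bsub>BijGroup \<Omega>\<^esub> inv\<^bsub>BijGroup \<Omega>\<^esub> x \<in> rel_code R"
    and uv: "(u, v) \<in> R" and u': "u' \<in> \<Omega>" "x (l u) = l u'" and v': "v' \<in> \<Omega>" "x (r v) = r v'"
  shows "(u', v') \<in> R"
proof -
  have "u \<in> \<Omega>" "v \<in> \<Omega>" using uv R by auto
  moreover have "cycle3 \<Omega> (l u) (r v) (r v) \<in> rel_code R" using uv by (auto simp: rel_code_def)
  ultimately have "cycle3 \<Omega> (l u') (r v') (r v') \<in> rel_code R"
    using pres x u' v' by (metis conjugate_cycle3 copies_mem)
  then show ?thesis using R u' v' by (blast intro: transposition_in_code)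
qed

text \<open>
  The preceding lemmas apply to \<open>x\<close> and to \<open>x\<inverse>\<close>. The map that \<open>x\<close> induces on \<open>\<Omega>\<close> through the
  copies preserves \<open>R\<close>; that it is onto and also reflects \<open>R\<close> comes from \<open>x\<inverse>\<close>.
\<close>

lemma rel_code_rigid:
  assumes x: "x \<in> Bij \<Omega>" and R: "R \<subseteq> \<Omega> \<times> \<Omega>" and inf: "infinite \<Omega>"
    and rigid: "relation_aut \<Omega> R = {\<lambda>z\<in>\<Omega>. z}"
    and pres: "\<forall>a\<in>rel_code R. x \<otimes>\<^bsub>BijGroup \<Omega>\<^esub> a \<otimes>\<^bsub>BijGroup \<Omega>\<^esub> inv\<^bsub>BijGroup \<Omega>\<^esub> x \<in> rel_code R"
    and pres': "\<forall>a\<in>rel_code R. inv\<^bsub>BijGroup \<Omega>\<^esub> x \<otimes>\<^bsub>BijGroup \<Omega>\<^esub> a \<otimes>\<^bsub>BijGroup \<Omega>\<^esub> x \<in> rel_code R"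
  shows "x = (\<lambda>z\<in>\<Omega>. z)"
proof -
  define y where "y = inv\<^bsub>BijGroup \<Omega>\<^esub> x"
  have y: "y \<in> Bij \<Omega>" and yx: "\<And>z. z \<in> \<Omega> \<Longrightarrow> y (x z) = z" and xy: "\<And>z. z \<in> \<Omega> \<Longrightarrow> x (y z) = z"
    using inv_BijGroup[OF x] by (simp_all add: y_def)
  have "inv\<^bsub>BijGroup \<Omega>\<^esub> y = x"
    using x unfolding y_def by (intro group.inv_inv group_BijGroup) (simp only: carrier_BijGroup)
  then have pres_y: "\<forall>a\<in>rel_code R. y \<otimes>\<^bsub>BijGroup \<Omega>\<^esub> a \<otimes>\<^bsub>BijGroup \<Omega>\<^esub> inv\<^bsub>BijGroup \<Omega>\<^esub> y \<in> rel_code R"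
    using pres' by (simp add: y_def)
  note acts = code_preserving_acts_on_copies[OF x R inf pres]
    and acts_y = code_preserving_acts_on_copies[OF y R inf pres_y]
  have "\<forall>u\<in>\<Omega>. \<exists>u'. u' \<in> \<Omega> \<and> x (l u) = l u' \<and> x (r u) = r u'" using acts(2) by blast
  then obtain s where s: "\<And>u. u \<in> \<Omega> \<Longrightarrow> s u \<in> \<Omega>"
    "\<And>u. u \<in> \<Omega> \<Longrightarrow> x (l u) = l (s u)" "\<And>u. u \<in> \<Omega> \<Longrightarrow> x (r u) = r (s u)"
    unfolding bchoice_iff by metis
  have inj_s: "inj_on s \<Omega>"
  proof (rule inj_onI)
    fix u v assume uv: "u \<in> \<Omega>" "v \<in> \<Omega>" "s u = s v"
    then have "x (l u) = x (l v)" by (simp add: s)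
    then show "u = v" using uv by (simp add: Bij_apply_eq_iff[OF x] copies_mem distinct)
  qed
  have surj_s: "\<exists>u\<in>\<Omega>. s u = w" if w: "w \<in> \<Omega>" for w
  proof -
    obtain u where u: "u \<in> \<Omega>" "y (l w) = l u" using acts_y(2) w by blast
    then have "l (s u) = l w" using s(2)[OF u(1)] xy[of "l w"] w by (simp add: copies_mem)
    then show ?thesis using u w s(1) by (auto simp: distinct)
  qed
  have "s ` \<Omega> = \<Omega>" using s(1) surj_s by blast
  then have "bij_betw s \<Omega> \<Omega>" using inj_s by (simp add: bij_betw_def)
  then have "restrict s \<Omega> \<in> Bij \<Omega>" by (simp add: Bij_def)
  moreover have "(u, v) \<in> R \<longleftrightarrow> (s u, s v) \<in> R" if uv: "u \<in> \<Omega>" "v \<in> \<Omega>" for u v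
  proof
    assume "(u, v) \<in> R"
    then show "(s u, s v) \<in> R"
      using code_preserving_preserves_rel[OF x R pres] s uv by blast
  next
    assume "(s u, s v) \<in> R"
    moreover have "y (l (s u)) = l u" "y (r (s v)) = r v"
      using uv yx[of "l u"] yx[of "r v"] by (simp_all add: s copies_mem)
    ultimately show "(u, v) \<in> R"
      using code_preserving_preserves_rel[OF y R pres_y] uv by blast
  qed
  ultimately have "restrict s \<Omega> \<in> relation_aut \<Omega> R" by (simp add: relation_aut_def)
  then have "restrict s \<Omega> = (\<lambda>z\<in>\<Omega>. z)" using rigid by blast
  then have s_id: "s u = u" if "u \<in> \<Omega>" for u using that by (metis restrict_apply')
  have "x z = z" if "z \<in> \<Omega>" for z
  proof -
    have "z \<in> insert p (l ` \<Omega> \<union> r ` \<Omega>)" using that by (subst (asm) split)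
    then show ?thesis using acts(1) s s_id by auto
  qed
  then show ?thesis
    using Bij_imp_extensional[OF x] by (auto simp: fun_eq_iff extensional_def)
qed

end

section \<open>Infinite cardinals and the group \<open>Sym(\<Omega>)\<close>\<close>

lemma exists_doubling:
  assumes "infinite \<Omega>"
  shows "\<exists>p l r. doubling \<Omega> p l r"
proof -
  obtain p where p: "p \<in> \<Omega>" using assms by fastforce
  have "\<exists>g. bij_betw g (\<Omega> <+> \<Omega>) \<Omega>"
    using card_of_Plus_infinite1[OF assms card_of_refl[THEN ordIso_imp_ordLeq]]
    by (simp add: card_of_ordIso)
  moreover have "\<exists>h. bij_betw h \<Omega> (\<Omega> - {p})"
    using infinite_imp_bij_betw[OF assms] .
  ultimately obtain f where f: "bij_betw f (\<Omega> <+> \<Omega>) (\<Omega> - {p})"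
    using bij_betw_trans by blast
  then have inj: "inj_on f (\<Omega> <+> \<Omega>)" and im: "f ` (\<Omega> <+> \<Omega>) = \<Omega> - {p}"
    by (simp_all add: bij_betw_def)
  have union: "(f \<circ> Inl) ` \<Omega> \<union> (f \<circ> Inr) ` \<Omega> = \<Omega> - {p}"
    unfolding im[symmetric] by (auto simp: Plus_def image_iff)
  have "doubling \<Omega> p (f \<circ> Inl) (f \<circ> Inr)"
  proof
    show "\<Omega> = insert p ((f \<circ> Inl) ` \<Omega> \<union> (f \<circ> Inr) ` \<Omega>)" using union p by blast
    show "p \<notin> (f \<circ> Inl) ` \<Omega>" "p \<notin> (f \<circ> Inr) ` \<Omega>" using union by blast+
    show "(f \<circ> Inl) ` \<Omega> \<inter> (f \<circ> Inr) ` \<Omega> = {}"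
      using inj by (auto dest!: inj_onD)
    show "inj_on (f \<circ> Inl) \<Omega>" "inj_on (f \<circ> Inr) \<Omega>"
      using inj by (auto intro!: inj_onI dest: inj_onD)
  qed
  then show ?thesis by blast
qed

lemma lesspoll_iff_card_of_ordLess: "A \<prec> B \<longleftrightarrow> (card_of A, card_of B) \<in> ordLess"
  unfolding lesspoll_def lepoll_def eqpoll_iff_card_of_ordIso card_of_ordLeq
  using ordLeq_iff_ordLess_or_ordIso not_ordLess_ordIso ordLess_imp_ordLeq by blast

lemma Un_lesspoll_infinite:
  assumes "infinite C" "A \<prec> C" "B \<prec> C"
  shows "A \<union> B \<prec> C"
  using assms card_of_Un_ordLess_infinite by (simp add: lesspoll_iff_card_of_ordLess)

lemma times_eqpoll_self_if_infinite: "infinite A \<Longrightarrow> A \<times> A \<approx> A"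
  by (simp add: eqpoll_iff_card_of_ordIso card_of_Times_same_infinite)

theorem theorem5p2:
  fixes \<Omega> :: "'a set" and R :: "('a \<times> 'a) set"
  assumes "infinite \<Omega>"
    and "R \<subseteq> \<Omega> \<times> \<Omega>"
    and "R \<prec> Bij \<Omega>"
    and "(\<Omega> \<times> \<Omega>) - R \<prec> Bij \<Omega>"
    and "relation_aut \<Omega> R = {\<lambda>x\<in>\<Omega>. x}"
  shows "\<exists>(G :: ('a \<Rightarrow> 'a) monoid) A B.
           group G \<and> infinite (carrier G) \<and>
           A \<subseteq> carrier G \<and> B \<subseteq> carrier G \<and> A \<inter> B = {} \<and>
           A \<prec> carrier G \<and> B \<prec> carrier G \<and>
           \<not> separable_in G A B"
proof -
  let ?G = "BijGroup \<Omega>"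
  obtain p l r where "doubling \<Omega> p l r" using exists_doubling[OF assms(1)] by blast
  then interpret doubling \<Omega> p l r .

  have square: "\<Omega> \<times> \<Omega> = R \<union> (\<Omega> \<times> \<Omega> - R)" using assms(2) by blast
  have "infinite (\<Omega> \<times> \<Omega>)" using assms(1) by (auto simp: finite_cartesian_product_iff)
  then have "infinite R \<or> infinite (\<Omega> \<times> \<Omega> - R)" using square by (metis finite_UnI)
  then have inf: "infinite (Bij \<Omega>)"
    using assms(3,4) by (meson lepoll_def lesspoll_def inj_on_finite)
  have square_less: "\<Omega> \<times> \<Omega> \<prec> Bij \<Omega>"
    using Un_lesspoll_infinite[OF inf assms(3,4)] square by simp

  define C where "C = (\<lambda>(a, b, c). cycle3 \<Omega> a b c) ` (\<Omega> \<times> \<Omega> \<times> \<Omega>)"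
  have "C \<lesssim> \<Omega> \<times> \<Omega> \<times> \<Omega>" unfolding C_def by (rule image_lepoll)
  also have "\<Omega> \<times> \<Omega> \<times> \<Omega> \<approx> \<Omega> \<times> \<Omega>"
    using times_eqpoll_self_if_infinite[OF assms(1)] by (simp add: times_eqpoll_cong)
  finally have C_less: "C \<prec> Bij \<Omega>"
    using square_less lesspoll_trans1 by blast
  have C_carrier: "C \<subseteq> carrier ?G" by (auto simp: C_def carrier_BijGroup intro: cycle3_Bij)
  have C_I: "cycle3 \<Omega> a b c \<in> C" if "a \<in> \<Omega>" "b \<in> \<Omega>" "c \<in> \<Omega>" for a b c
    using that unfolding C_def by (intro image_eqI[of _ _ "(a, b, c)"]) auto
  have A_C: "rel_code R \<subseteq> C"
    using assms(2) unfolding rel_code_def by (auto intro!: C_I copies_mem p_mem)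
  have "\<not> separable_in ?G (rel_code R) (C - rel_code R)"
  proof (rule group.not_separable_if_rigid[OF group_BijGroup A_C C_carrier])
    fix x a assume x: "x \<in> carrier ?G" and "a \<in> C"
    then obtain i j k where "i \<in> \<Omega>" "j \<in> \<Omega>" "k \<in> \<Omega>" "a = cycle3 \<Omega> i j k"
      by (auto simp: C_def)
    then show "x \<otimes>\<^bsub>?G\<^esub> a \<otimes>\<^bsub>?G\<^esub> inv\<^bsub>?G\<^esub> x \<in> C"
      using x by (simp add: carrier_BijGroup conjugate_cycle3 C_I Bij_apply_mem)
  next
    fix x assume "x \<in> carrier ?G"
      "\<forall>a\<in>rel_code R. x \<otimes>\<^bsub>?G\<^esub> a \<otimes>\<^bsub>?G\<^esub> inv\<^bsub>?G\<^esub> x \<in> rel_code R"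
      "\<forall>a\<in>rel_code R. inv\<^bsub>?G\<^esub> x \<otimes>\<^bsub>?G\<^esub> a \<otimes>\<^bsub>?G\<^esub> x \<in> rel_code R"
    then have "x = (\<lambda>z\<in>\<Omega>. z)"
      using rel_code_rigid assms(1,2,5) by (simp add: carrier_BijGroup)
    then show "x = \<one>\<^bsub>?G\<^esub>" by (simp only: one_BijGroup)
  qed
  moreover have "rel_code R \<prec> Bij \<Omega>" "C - rel_code R \<prec> Bij \<Omega>"
    by (rule lesspoll_trans1[OF subset_imp_lepoll C_less]; use A_C in blast)+
  ultimately show ?thesis
    using group_BijGroup inf A_C C_carrier
    by (intro exI[of _ ?G] exI[of _ "rel_code R"] exI[of _ "C - rel_code R"]) (auto simp: carrier_BijGroup)
qed

end
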